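(* Let $\dot x=f(x,\alpha)$, $x\in\mathbb R^3$, $\alpha\in\mathbb R$, be a smooth system satisfying hypotheses (H1)–(H4) listed in the context, with the notation $\gamma,\sigma,g,W^{cs}(\alpha),\Sigma,h_{cs},D,\sigma_v,\sigma_w,\psi_*$ introduced there. For $(v,\alpha)$ near $(0,0)$ let $t\mapsto z_*(v,\alpha)(t)$, of at most algebraic growth as $t\to\infty$, be the solution of $\dot z=A(t)z+g(t,z,\alpha)$ with initial condition $z_*(v,\alpha)(0)=(v,h_{cs}(v,\alpha))$ with respect to the $(v,w)$-coordinates, on $W^{cs}(\alpha)\cap\Sigma\subset\{u=0\}$. Then $$D(v,\alpha)=\int_0^\infty\Big\langle\psi_*(s),\;g\big(s,z_*(v,\alpha)(s),\alpha\big)-\sigma_w\,g\big(s,z_*(\sigma_v v,\alpha)(s),\alpha\big)\Big\rangle\,ds .$$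
   Context: For $\nu>0$, $C_{b,+}(\nu)$ (resp. $C_{b,-}(\nu)$) is the Banach space of continuous $x:[0,\infty)\to\mathbb R^3$ (resp. $(-\infty,0]\to\mathbb R^3$) with $\sup|x(t)|(|t|+1)^{-\nu}<\infty$; functions in $C_{b,\pm}(\nu)$ for some large $\nu$ are said to have algebraic growth as $t\to\pm\infty$. Hypotheses: (H1) There is a linear involution $\sigma\in\mathbb R^{3\times3}$, $\sigma^2=\mathrm{id}$, with $f(\sigma x,\alpha)=-\sigma f(x,\alpha)$ for all $x,\alpha$ (so if $x(t)$ is a solution, so is $\sigma x(-t)$). (H2) For $\alpha=0$ there is a symmetric solution $\gamma(t)$, $t\in\mathbb R$ (i.e. $\gamma(t)=\sigma\gamma(-t)$), of at most algebraic growth as $t\to\pm\infty$, with $\gamma(0)=0$. (H3) The extended system $\dot x=f(x,\alpha),\ \dot\alpha=0$ has a three-dimensional smooth invariant manifold $W^{cs}$ consisting of all solution curves $(x(t),\alpha)$ near (and including) $(\gamma(t),0)$ with $x\in C_{b,+}(\nu)$ for $\nu$ large enough. It is foliated by two-dimensional invariant manifolds $W^{cs}(\alpha)$. Put $W^{cu}(\alpha):=\sigma W^{cs}(\alpha)$. (H4) With $U=\mathrm{span}(\dot\gamma(0))$, there is a one-dimensional linear space $V$ such that $T_{\gamma(0)}W^{cs}(0)\cap T_{\gamma(0)}W^{cu}(0)=U\oplus V$ is two-dimensional. Notation: $W=(T_{\gamma(0)}W^{cs}(0))^\perp$; $e_u,e_v,e_w$ are unit vectors spanning $U,V,W$ with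 coordinates $(u,v,w)$. $V$ and $W$ are invariant under $\sigma$ and $\sigma^T$ respectively, $\sigma|_V=\sigma_v\,\mathrm{id}$, $\sigma^T|_W=\sigma_w\,\mathrm{id}$ with $\sigma_v,\sigma_w\in\{\pm1\}$, and in the $(u,v,w)$-coordinates $\sigma=\mathrm{diag}(-1,\sigma_v,\sigma_w)$. $\Sigma=(V\oplus W)\cap B_r$, $B_r$ a small ball about $\gamma(0)=0$. $A(t)=D_xf(\gamma(t),0)$ and $g(t,z,\alpha)=f(\gamma(t)+z,\alpha)-f(\gamma(t),0)-A(t)z$; $\Phi(t,s)$ is the state-transition matrix of $\dot z=A(t)z$. There are projections $P(t)$, $Q(t)=\mathrm{id}-P(t)$, $t\ge0$, continuous in $t$, with $P(t)\Phi(t,s)=\Phi(t,s)P(s)$, $\mathrm{Range}\,P(0)=U\oplus V$, $\ker P(0)=W$, and $\|\Phi(t,s)P(s)\|\le K(t-s+1)^\theta$, $\|\Phi(s,t)Q(t)\|\le Ke^{-\eta(t-s)}$ for $0\le s\le t$, with constants $K\ge 1$, $\theta\ge 0$, $\eta>0$. $\psi_*(t)=\Phi(0,t)^Te_w$ is the solution of $\dot\psi+A(t)^T\psi=0$ with $\psi_*(0)=e_w$; it decays exponentially as $t\to\pm\infty$. As in center manifold theory, $f$ (hence $g$) is assumed to have been cut off so that, for each small $(v,\alpha)$, there is a unique $z_*(v,\alpha)\in C_{b,+}(\nu)$ solving $z(t)=\Phi(t,0)v+\int_0^tP(t)\Phi(t,s)g(s,z(s),\alpha)ds+\int_\infty^tQ(t)\Phi(t,s)g(s,z(s),\alpha)ds$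 (with $v$ identified with $v e_v$), and these solutions parametrize $W^{cs}(\alpha)$ (in the variable $z=x-\gamma(t)$). Locally $W^{cs}(\alpha)\cap\Sigma$ and $W^{cu}(\alpha)\cap\Sigma$ are graphs $w=h_{cs}(v,\alpha)$, $w=h_{cu}(v,\alpha)$ in the $(v,w)$-plane, and $D(v,\alpha):=h_{cu}(v,\alpha)-h_{cs}(v,\alpha)$. *)

theory Defs
  imports "HOL-Analysis.Analysis"
begin

section \<open>Smooth maps and submanifolds of Euclidean spaces\<close>

text \<open>Meant for open \<open>S\<close>: \<open>C\<^sup>n\<close>-regularity by iterated directional (Frechet) derivatives.\<close>

primrec higher_differentiable_on ::
    "nat \<Rightarrow> 'a::real_normed_vector set \<Rightarrow> ('a \<Rightarrow> 'b::real_normed_vector) \<Rightarrow> bool" where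
  "higher_differentiable_on 0 S f \<longleftrightarrow> continuous_on S f"
| "higher_differentiable_on (Suc n) S f \<longleftrightarrow>
     (\<forall>x\<in>S. f differentiable (at x)) \<and>
     (\<forall>h. higher_differentiable_on n S (\<lambda>x. frechet_derivative f (at x) h))"

definition smooth_on :: "'a::real_normed_vector set \<Rightarrow> ('a \<Rightarrow> 'b::real_normed_vector) \<Rightarrow> bool" where
  "smooth_on S f \<longleftrightarrow> (\<forall>n. higher_differentiable_on n S f)"

text \<open>Embedded submanifolds without boundary, by local straightening diffeomorphisms.\<close>

definition smooth_submanifold :: "nat \<Rightarrow> 'a::euclidean_space set \<Rightarrow> bool" where
  "smooth_submanifold k M \<longleftrightarrow>
     (\<forall>p\<in>M. \<exists>N N' \<phi> \<phi>' L.
        open N \<and> p \<in> N \<and> open (N' :: 'a set) \<and> homeomorphism N N' \<phi> \<phi>' \<and>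
        smooth_on N \<phi> \<and> smooth_on N' \<phi>' \<and>
        subspace L \<and> dim L = k \<and> \<phi> ` (M \<inter> N) = L \<inter> N')"

definition tangent_space :: "'a::euclidean_space set \<Rightarrow> 'a \<Rightarrow> 'a set" where
  "tangent_space M p =
     {\<xi>. \<exists>c \<epsilon>. 0 < \<epsilon> \<and> smooth_on {-\<epsilon><..<\<epsilon>} c \<and> c ` {-\<epsilon><..<\<epsilon>} \<subseteq> M \<and>
            c (0::real) = p \<and> (c has_vector_derivative \<xi>) (at 0)}"


section \<open>Functions of algebraic growth\<close>

text \<open>Only the values on the half line matter for membership.\<close>

definition Cb_plus :: "real \<Rightarrow> (real \<Rightarrow> real^3) set" where
  "Cb_plus \<nu> = {x. continuous_on {0..} x \<and>
                 bdd_above ((\<lambda>t. norm (x t) * (\<bar>t\<bar> + 1) powr (- \<nu>)) ` {0..})}"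

definition Cb_minus :: "real \<Rightarrow> (real \<Rightarrow> real^3) set" where
  "Cb_minus \<nu> = {x. continuous_on {..0} x \<and>
                  bdd_above ((\<lambda>t. norm (x t) * (\<bar>t\<bar> + 1) powr (- \<nu>)) ` {..0})}"

definition algebraic_growth_plus :: "(real \<Rightarrow> real^3) \<Rightarrow> bool" where
  "algebraic_growth_plus x \<longleftrightarrow> (\<exists>\<nu>>0. x \<in> Cb_plus \<nu>)"

definition algebraic_growth_minus :: "(real \<Rightarrow> real^3) \<Rightarrow> bool" where
  "algebraic_growth_minus x \<longleftrightarrow> (\<exists>\<nu>>0. x \<in> Cb_minus \<nu>)"


section \<open>The reversible system and its center-stable manifold\<close>

definition solution_on ::
    "(real^3 \<Rightarrow> real \<Rightarrow> real^3) \<Rightarrow> real \<Rightarrow> real set \<Rightarrow> (real \<Rightarrow> real^3) \<Rightarrow> bool" where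
  "solution_on f \<alpha> I x \<longleftrightarrow> (\<forall>t\<in>I. (x has_vector_derivative f (x t) \<alpha>) (at t within I))"

definition H1 :: "(real^3 \<Rightarrow> real \<Rightarrow> real^3) \<Rightarrow> real^3^3 \<Rightarrow> bool" where
  "H1 f \<sigma> \<longleftrightarrow> \<sigma> ** \<sigma> = mat 1 \<and> (\<forall>x \<alpha>. f (\<sigma> *v x) \<alpha> = - (\<sigma> *v f x \<alpha>))"

definition H2 :: "(real^3 \<Rightarrow> real \<Rightarrow> real^3) \<Rightarrow> real^3^3 \<Rightarrow> (real \<Rightarrow> real^3) \<Rightarrow> bool" where
  "H2 f \<sigma> \<gamma> \<longleftrightarrow> solution_on f 0 UNIV \<gamma> \<and> (\<forall>t. \<gamma> t = \<sigma> *v \<gamma> (- t)) \<and>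
     algebraic_growth_plus \<gamma> \<and> algebraic_growth_minus \<gamma> \<and> \<gamma> 0 = 0"

text \<open>\<open>M\<close> is the center-stable manifold of the extended system in \<open>(x, \<alpha>)\<close>-space;
  its leaf at \<open>\<alpha>\<close> is \<open>W\<^sup>c\<^sup>s(\<alpha>)\<close>.\<close>

definition Wcs :: "((real^3) \<times> real) set \<Rightarrow> real \<Rightarrow> (real^3) set" where
  "Wcs M \<alpha> = {x. (x, \<alpha>) \<in> M}"

definition Wcu :: "real^3^3 \<Rightarrow> ((real^3) \<times> real) set \<Rightarrow> real \<Rightarrow> (real^3) set" where
  "Wcu \<sigma> M \<alpha> = (\<lambda>x. \<sigma> *v x) ` Wcs M \<alpha>"

text \<open>Nearness of a solution curve to \<open>\<gamma>\<close> is measured in the weighted norm of \<open>Cb_plus \<nu>\<close>.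
  The third conjunct gives both invariance and the growth of the solution curves in \<open>M\<close>,
  the last one says that \<open>M\<close> contains all such curves near \<open>\<gamma>\<close>.\<close>

definition H3 :: "(real^3 \<Rightarrow> real \<Rightarrow> real^3) \<Rightarrow> (real \<Rightarrow> real^3) \<Rightarrow> real \<Rightarrow>
    ((real^3) \<times> real) set \<Rightarrow> bool" where
  "H3 f \<gamma> \<nu> M \<longleftrightarrow>
     smooth_submanifold 3 M \<and>
     (\<forall>\<alpha>. smooth_submanifold 2 (Wcs M \<alpha>)) \<and>
     (\<forall>(x0, \<alpha>)\<in>M. \<exists>x\<in>Cb_plus \<nu>. solution_on f \<alpha> {0..} x \<and> x 0 = x0 \<and>
        (\<forall>t\<ge>0. (x t, \<alpha>) \<in> M)) \<and>
     (\<forall>t. (\<gamma> t, 0) \<in> M) \<and>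
     (\<exists>\<epsilon>>0. \<forall>\<alpha>. \<forall>x\<in>Cb_plus \<nu>. \<bar>\<alpha>\<bar> < \<epsilon> \<longrightarrow> solution_on f \<alpha> {0..} x \<longrightarrow>
        (\<forall>t\<ge>0. norm (x t - \<gamma> t) * (\<bar>t\<bar> + 1) powr (- \<nu>) < \<epsilon>) \<longrightarrow>
        (\<forall>t\<ge>0. (x t, \<alpha>) \<in> M))"

definition H4 :: "real^3^3 \<Rightarrow> (real \<Rightarrow> real^3) \<Rightarrow> ((real^3) \<times> real) set \<Rightarrow>
    (real^3) set \<Rightarrow> (real^3) set \<Rightarrow> bool" where
  "H4 \<sigma> \<gamma> M U V \<longleftrightarrow>
     U = span {vector_derivative \<gamma> (at 0)} \<and> subspace V \<and> dim V = 1 \<and>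
     U \<inter> V = {0} \<and>
     tangent_space (Wcs M 0) (\<gamma> 0) \<inter> tangent_space (Wcu \<sigma> M 0) (\<gamma> 0) = U + V \<and>
     dim (U + V) = 2"


section \<open>Linearization along \<open>\<gamma>\<close>\<close>

definition lin :: "(real^3 \<Rightarrow> real \<Rightarrow> real^3) \<Rightarrow> (real \<Rightarrow> real^3) \<Rightarrow> real \<Rightarrow> real^3^3" where
  "lin f \<gamma> t = jacobian (\<lambda>x. f x 0) (at (\<gamma> t))"

definition remainder :: "(real^3 \<Rightarrow> real \<Rightarrow> real^3) \<Rightarrow> (real \<Rightarrow> real^3) \<Rightarrow>
    real \<Rightarrow> real^3 \<Rightarrow> real \<Rightarrow> real^3" where
  "remainder f \<gamma> t z \<alpha> = f (\<gamma> t + z) \<alpha> - f (\<gamma> t) 0 - lin f \<gamma> t *v z"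

definition state_transition :: "(real \<Rightarrow> real^3^3) \<Rightarrow> (real \<Rightarrow> real \<Rightarrow> real^3^3) \<Rightarrow> bool" where
  "state_transition A \<Phi> \<longleftrightarrow>
     (\<forall>s. \<Phi> s s = mat 1 \<and>
        (\<forall>t. ((\<lambda>t. \<Phi> t s) has_vector_derivative A t ** \<Phi> t s) (at t)))"

definition psi_star :: "(real \<Rightarrow> real \<Rightarrow> real^3^3) \<Rightarrow> real^3 \<Rightarrow> real \<Rightarrow> real^3" where
  "psi_star \<Phi> e\<^sub>w t = transpose (\<Phi> 0 t) *v e\<^sub>w"

definition dichotomy_projections :: "(real \<Rightarrow> real \<Rightarrow> real^3^3) \<Rightarrow> (real \<Rightarrow> real^3^3) \<Rightarrow>
    (real^3) set \<Rightarrow> (real^3) set \<Rightarrow> (real^3) set \<Rightarrow> bool" where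
  "dichotomy_projections \<Phi> P U V W \<longleftrightarrow>
     (\<forall>t\<ge>0. P t ** P t = P t) \<and> continuous_on {0..} P \<and>
     (\<forall>s\<ge>0. \<forall>t\<ge>0. P t ** \<Phi> t s = \<Phi> t s ** P s) \<and>
     range (\<lambda>x. P 0 *v x) = U + V \<and> {x. P 0 *v x = 0} = W \<and>
     (\<exists>K \<theta> \<eta>. 1 \<le> K \<and> 0 \<le> \<theta> \<and> 0 < \<eta> \<and>
        (\<forall>s t. 0 \<le> s \<and> s \<le> t \<longrightarrow>
           onorm (\<lambda>x. (\<Phi> t s ** P s) *v x) \<le> K * (t - s + 1) powr \<theta> \<and>
           onorm (\<lambda>x. (\<Phi> s t ** (mat 1 - P t)) *v x) \<le> K * exp (- \<eta> * (t - s))))"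

text \<open>The fixed point equation of the center-stable manifold; the integral from \<open>\<infinity>\<close> to \<open>t\<close>
  is minus the integral over \<open>{t..}\<close>, whose convergence is part of being a solution.\<close>

definition cs_fixed_point :: "(real^3 \<Rightarrow> real \<Rightarrow> real^3) \<Rightarrow> (real \<Rightarrow> real^3) \<Rightarrow> real \<Rightarrow>
    (real \<Rightarrow> real \<Rightarrow> real^3^3) \<Rightarrow> (real \<Rightarrow> real^3^3) \<Rightarrow> real^3 \<Rightarrow>
    real \<Rightarrow> real \<Rightarrow> (real \<Rightarrow> real^3) \<Rightarrow> bool" where
  "cs_fixed_point f \<gamma> \<nu> \<Phi> P e\<^sub>v v \<alpha> z \<longleftrightarrow>
     z \<in> Cb_plus \<nu> \<and>
     (\<forall>t\<ge>0.
        (\<lambda>s. (P t ** \<Phi> t s) *v remainder f \<gamma> s (z s) \<alpha>) integrable_on {0..t} \<and>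
        (\<lambda>s. ((mat 1 - P t) ** \<Phi> t s) *v remainder f \<gamma> s (z s) \<alpha>) integrable_on {t..} \<and>
        z t = \<Phi> t 0 *v (v *\<^sub>R e\<^sub>v)
              + integral {0..t} (\<lambda>s. (P t ** \<Phi> t s) *v remainder f \<gamma> s (z s) \<alpha>)
              - integral {t..} (\<lambda>s. ((mat 1 - P t) ** \<Phi> t s) *v remainder f \<gamma> s (z s) \<alpha>))"

text \<open>What the cut-off of \<open>f\<close> achieves.  Since \<open>Wcs M \<alpha>\<close> is invariant, that the solutions
  parametrize it means that their orbits lie in it and that their initial values exhaust it
  in the section \<open>S\<close>.\<close>

definition cut_off :: "(real^3 \<Rightarrow> real \<Rightarrow> real^3) \<Rightarrow> (real \<Rightarrow> real^3) \<Rightarrow> real \<Rightarrow>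
    ((real^3) \<times> real) set \<Rightarrow> (real \<Rightarrow> real \<Rightarrow> real^3^3) \<Rightarrow> (real \<Rightarrow> real^3^3) \<Rightarrow>
    real^3 \<Rightarrow> real^3 \<Rightarrow> (real^3) set \<Rightarrow> bool" where
  "cut_off f \<gamma> \<nu> M \<Phi> P e\<^sub>v e\<^sub>w S \<longleftrightarrow>
     (\<forall>\<^sub>F (v, \<alpha>) in nhds (0, 0).
        (\<exists>z. cs_fixed_point f \<gamma> \<nu> \<Phi> P e\<^sub>v v \<alpha> z \<and>
             (\<forall>z'. cs_fixed_point f \<gamma> \<nu> \<Phi> P e\<^sub>v v \<alpha> z' \<longrightarrow> (\<forall>t\<ge>0. z' t = z t)) \<and>
             (\<forall>t\<ge>0. \<gamma> t + z t \<in> Wcs M \<alpha>) \<and>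
             (\<forall>w. v *\<^sub>R e\<^sub>v + w *\<^sub>R e\<^sub>w \<in> Wcs M \<alpha> \<inter> S \<longrightarrow>
                v *\<^sub>R e\<^sub>v + w *\<^sub>R e\<^sub>w = \<gamma> 0 + z 0)))"

definition local_graph :: "real^3 \<Rightarrow> real^3 \<Rightarrow> (real^3) set \<Rightarrow>
    (real \<Rightarrow> (real^3) set) \<Rightarrow> (real \<Rightarrow> real \<Rightarrow> real) \<Rightarrow> bool" where
  "local_graph e\<^sub>v e\<^sub>w S L h \<longleftrightarrow>
     (\<forall>\<^sub>F (v, \<alpha>) in nhds (0, 0).
        \<forall>w. v *\<^sub>R e\<^sub>v + w *\<^sub>R e\<^sub>w \<in> L \<alpha> \<inter> S \<longleftrightarrow> w = h v \<alpha>)"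

definition splitting :: "(real \<Rightarrow> real \<Rightarrow> real) \<Rightarrow> (real \<Rightarrow> real \<Rightarrow> real) \<Rightarrow> real \<Rightarrow> real \<Rightarrow> real" where
  "splitting h\<^sub>c\<^sub>s h\<^sub>c\<^sub>u v \<alpha> = h\<^sub>c\<^sub>u v \<alpha> - h\<^sub>c\<^sub>s v \<alpha>"

end

theory Submission
  imports Defs "HOL-Real_Asymp.Real_Asymp"
begin

text \<open>Along a solution \<open>z\<close> of \<open>z' = A z + g\<close> the adjoint solution \<open>\<psi>\<close> satisfies
  \<open>(\<psi> \<bullet> z)' = \<psi> \<bullet> g\<close>. Since \<open>e\<^sub>w\<close> is orthogonal to the range of \<open>P 0\<close>, the dichotomy makes \<open>\<psi>\<close>
  decay exponentially, which beats the algebraic growth of \<open>z\<close>; integrating over the half line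
  leaves \<open>h\<^sub>c\<^sub>s v \<alpha> = - \<integral> \<psi> \<bullet> g\<close>. Reversibility gives \<open>h\<^sub>c\<^sub>u v \<alpha> = \<sigma>\<^sub>w * h\<^sub>c\<^sub>s (\<sigma>\<^sub>v * v) \<alpha>\<close>,
  and the difference of the two is the claim.\<close>

section \<open>Calculus tools: the half line, a Gronwall bound and a product rule\<close>

text \<open>An integral over an unbounded set is a limit over growing boxes, so convergence of
  \<open>F\<close> at infinity yields both integrability of \<open>f\<close> and the value.\<close>

lemma has_integral_halfline_FTC:
  fixes F f :: "real \<Rightarrow> 'a::banach"
  assumes der: "\<And>t. 0 \<le> t \<Longrightarrow> (F has_vector_derivative f t) (at t within {0..})"
    and lim: "(F \<longlongrightarrow> l) at_top"
  shows "(f has_integral (l - F 0)) {0..}"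
proof (subst has_integral', intro allI impI)
  fix e :: real assume "0 < e"
  then obtain N where N: "\<And>t. N \<le> t \<Longrightarrow> dist (F t) l < e"
    using tendstoD[OF lim \<open>0 < e\<close>] unfolding eventually_at_top_linorder by auto
  show "\<exists>B>0. \<forall>a b. ball 0 B \<subseteq> cbox a b \<longrightarrow>
      (\<exists>z. ((\<lambda>x. if x \<in> {0..} then f x else 0) has_integral z) (cbox a b) \<and>
        norm (z - (l - F 0)) < e)"
  \<comment> \<open>This radius puts \<open>0\<close> and \<open>\<bar>N\<bar>\<close> into the
    ball, hence into the box, so the truncated integral starts at \<open>0\<close> and ends at some
    \<open>b\<close> with \<open>N \<le> b\<close>.\<close>
  proof (intro exI[of _ "\<bar>N\<bar> + 1"] conjI allI impI)
    fix a b :: real assume sub: "ball 0 (\<bar>N\<bar> + 1) \<subseteq> cbox a b"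
    have "0 \<in> ball 0 (\<bar>N\<bar> + 1)" "\<bar>N\<bar> \<in> ball 0 (\<bar>N\<bar> + 1)"
      by auto
    then have "0 \<in> cbox a b" "\<bar>N\<bar> \<in> cbox a b"
      using sub by blast+
    then have ab: "a \<le> 0" "0 \<le> b" "N \<le> b"
      by auto
    have "(f has_integral (F b - F 0)) {0..b}"
      by (rule fundamental_theorem_of_calculus)
        (use ab in \<open>auto intro: has_vector_derivative_within_subset[OF der]\<close>)
    then have "((\<lambda>x. if x \<in> {0..b} then f x else 0) has_integral (F b - F 0)) (cbox a b)"
      using ab by (subst has_integral_restrict) auto
    then have "((\<lambda>x. if x \<in> {0..} then f x else 0) has_integral (F b - F 0)) (cbox a b)"
      by (rule has_integral_eq[rotated]) auto
    moreover have "norm (F b - F 0 - (l - F 0)) < e"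
      using N[OF ab(3)] by (simp add: dist_norm)
    ultimately show "\<exists>z. ((\<lambda>x. if x \<in> {0..} then f x else 0) has_integral z) (cbox a b) \<and>
        norm (z - (l - F 0)) < e"
      by blast
  qed auto
qed

text \<open>By Cauchy-Schwarz, \<open>exp (2 * L * t) * (y t \<bullet> y t)\<close> is
  nondecreasing; the squared norm keeps it differentiable at zeros of \<open>y\<close>. The later
  value bounds the earlier one, the direction required for the backward transition
  \<open>\<Phi> 0 t\<close>.\<close>

lemma backward_Gronwall:
  fixes y y' :: "real \<Rightarrow> 'a::real_inner"
  assumes "a \<le> b"
    and der: "\<And>t. \<lbrakk>a \<le> t; t \<le> b\<rbrakk> \<Longrightarrow> (y has_vector_derivative y' t) (at t)"
    and bound: "\<And>t. \<lbrakk>a \<le> t; t \<le> b\<rbrakk> \<Longrightarrow> norm (y' t) \<le> L * norm (y t)"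
  shows "norm (y a) \<le> exp (L * (b - a)) * norm (y b)"
proof -
  define h where "h t = exp (2 * L * t) * (y t \<bullet> y t)" for t
  have "h a \<le> h b"
  proof (rule DERIV_nonneg_imp_nondecreasing[OF \<open>a \<le> b\<close>])
    fix t assume t: "a \<le> t" "t \<le> b"
    have inner: "((\<lambda>t. y t \<bullet> y t) has_real_derivative (y t \<bullet> y' t + y' t \<bullet> y t)) (at t)"
      unfolding has_real_derivative_iff_has_vector_derivative
      by (rule bounded_bilinear.has_vector_derivative[OF bounded_bilinear_inner der[OF t] der[OF t]])
    have "(h has_real_derivative
        exp (2 * L * t) * (2 * L * (y t \<bullet> y t) + 2 * (y t \<bullet> y' t))) (at t)"
      unfolding h_def
      by (rule derivative_eq_intros inner refl)+ (simp add: inner_commute algebra_simps)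
    moreover have "- (L * (y t \<bullet> y t)) \<le> y t \<bullet> y' t"
    proof -
      have "\<bar>y t \<bullet> y' t\<bar> \<le> norm (y t) * norm (y' t)"
        by (rule Cauchy_Schwarz_ineq2)
      also have "\<dots> \<le> norm (y t) * (L * norm (y t))"
        by (intro mult_left_mono bound t) auto
      also have "\<dots> = L * (y t \<bullet> y t)"
        by (simp add: dot_square_norm power2_eq_square)
      finally show ?thesis by linarith
    qed
    then have "0 \<le> exp (2 * L * t) * (2 * L * (y t \<bullet> y t) + 2 * (y t \<bullet> y' t))"
      by simp
    ultimately show "\<exists>d. DERIV h t :> d \<and> 0 \<le> d"
      by blast
  qed
  have sq: "(exp (L * t) * norm (y t))\<^sup>2 = h t" for t
    by (simp add: h_def power_mult_distrib dot_square_norm flip: exp_double)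
  have "(exp (L * a) * norm (y a))\<^sup>2 \<le> (exp (L * b) * norm (y b))\<^sup>2"
    using \<open>h a \<le> h b\<close> unfolding sq .
  then have "exp (L * a) * norm (y a) \<le> exp (L * b) * norm (y b)"
    by (rule power2_le_imp_le) simp
  then show ?thesis
    by (simp add: right_diff_distrib exp_diff field_simps)
qed

text \<open>The bracket \<open>z s - B s (C t (z t)) - (s - t) B s (C t g)\<close> vanishes to first order at \<open>t\<close>,
  and \<open>C s\<close> maps it to the first-order remainder of \<open>C s (z s)\<close>; boundedness of \<open>C\<close>
  thus replaces its differentiability.\<close>

lemma has_vector_derivative_inverse_apply:
  fixes B C :: "real \<Rightarrow> 'a::real_normed_vector \<Rightarrow> 'a"
  assumes B: "\<And>w. ((\<lambda>s. B s w) has_vector_derivative D w) (at t within S)"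
    and z: "(z has_vector_derivative D (C t (z t)) + g) (at t within S)"
    and lin: "\<And>s. linear (C s)"
    and CB: "\<And>s w. s \<in> S \<Longrightarrow> C s (B s w) = w"
    and BC: "\<And>w. B t (C t w) = w"
    and bound: "\<And>s w. s \<in> S \<Longrightarrow> norm (C s w) \<le> K * norm w"
  shows "((\<lambda>s. C s (z s)) has_vector_derivative C t g) (at t within S)"
proof -
  define \<zeta> where "\<zeta> s = z s - B s (C t (z t)) - (s - t) *\<^sub>R B s (C t g)" for s
  have "(\<zeta> has_vector_derivative
      D (C t (z t)) + g - D (C t (z t)) - ((t - t) *\<^sub>R D (C t g) + 1 *\<^sub>R B t (C t g))) (at t within S)"
    unfolding \<zeta>_def
    by (intro has_vector_derivative_diff z B has_vector_derivative_scaleR)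
      (auto intro!: derivative_eq_intros)
  then have \<zeta>: "(\<zeta> has_vector_derivative 0) (at t within S)"
    by (simp add: BC)
  have \<zeta>t: "\<zeta> t = 0"
    by (simp add: \<zeta>_def BC)
  have rem: "C s (z s) - C t (z t) - (s - t) *\<^sub>R C t g = C s (\<zeta> s)" if "s \<in> S" for s
    using that by (simp add: \<zeta>_def linear_diff[OF lin] linear_cmul[OF lin] CB)
  have lim: "((\<lambda>s. norm (\<zeta> s) / norm (s - t)) \<longlongrightarrow> 0) (at t within S)"
    using \<zeta> by (simp add: has_vector_derivative_def has_derivative_iff_norm \<zeta>t)
  have "((\<lambda>s. norm (C s (z s) - C t (z t) - (s - t) *\<^sub>R C t g) / norm (s - t)) \<longlongrightarrow> 0) (at t within S)"
  proof (rule Lim_null_comparison)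
    show "((\<lambda>s. K * (norm (\<zeta> s) / norm (s - t))) \<longlongrightarrow> 0) (at t within S)"
      using tendsto_mult_right_zero[OF lim] by blast
    show "\<forall>\<^sub>F s in at t within S.
        norm (norm (C s (z s) - C t (z t) - (s - t) *\<^sub>R C t g) / norm (s - t))
        \<le> K * (norm (\<zeta> s) / norm (s - t))"
      unfolding eventually_at_filter
      by (rule always_eventually) (auto simp: rem divide_simps intro!: bound)
  qed
  then show ?thesis
    by (simp add: has_vector_derivative_def has_derivative_iff_norm bounded_linear_scaleR_left)
qed

section \<open>Linearization along \<gamma> and its state-transition matrix\<close>

lemma bounded_bilinear_matrix_vector_mult:
  "bounded_bilinear ((*v) :: real^'n^'m \<Rightarrow> real^'n \<Rightarrow> real^'m)"
  unfolding bilinear_conv_bounded_bilinear[symmetric] bilinear_def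
  by (auto intro!: linearI simp: matrix_vector_mult_add_rdistrib matrix_vector_right_distrib
      scaleR_matrix_vector_assoc matrix_vector_mult_scaleR)

text \<open>The entries of the Jacobian in \<open>x\<close> are components of derivatives of the
  joint map in directions \<open>(h, 0)\<close>, which are continuous by first-order
  smoothness.\<close>

lemma continuous_lin:
  assumes smooth: "smooth_on UNIV (\<lambda>(x, \<alpha>). f x \<alpha>)" and \<gamma>: "continuous_on UNIV \<gamma>"
  shows "continuous_on UNIV (lin f \<gamma>)"
proof -
  let ?F = "\<lambda>(x, \<alpha>). f x \<alpha>"
  have "higher_differentiable_on (Suc 0) UNIV ?F"
    using smooth unfolding smooth_on_def by blast
  then have diff: "?F differentiable (at p)"
    and cont: "continuous_on UNIV (\<lambda>p. frechet_derivative ?F (at p) h)" for p h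
    unfolding higher_differentiable_on.simps by blast+
  have eq: "frechet_derivative (\<lambda>x. f x 0) (at x) h = frechet_derivative ?F (at (x, 0)) (h, 0)"
    for x h
  proof -
    have "((\<lambda>x. ?F (x, 0)) has_derivative (\<lambda>h. frechet_derivative ?F (at (x, 0)) (h, 0))) (at x)"
      by (rule has_derivative_compose[of "\<lambda>x. (x, 0)" "\<lambda>h. (h, 0)"])
        (auto intro!: derivative_eq_intros diff[unfolded frechet_derivative_works])
    then show ?thesis
      by (simp add: frechet_derivative_at[symmetric])
  qed
  have "continuous_on UNIV (\<lambda>t. frechet_derivative ?F (at (\<gamma> t, 0)) (h, 0) $ i)" for h i
    by (intro continuous_intros continuous_on_compose2[OF cont] \<gamma>) auto
  then show ?thesis
    unfolding lin_def jacobian_def matrix_def eq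
    by (intro continuous_on_vec_lambda)
qed

text \<open>\<open>A\<close> is bounded on the compact interval, so Gronwall applies to solutions
  there. Started at time \<open>t\<close> and run back to \<open>0\<close>, it bounds
  \<open>\<Phi> 0 t\<close>; applied to a difference of solutions, it gives uniqueness and with it
  the inverse relation.\<close>

lemma state_transition_inverse:
  assumes \<Phi>: "state_transition A \<Phi>" and A: "continuous_on UNIV A" and "0 \<le> T"
  obtains K where "\<And>t w. t \<in> {0..T} \<Longrightarrow> norm (\<Phi> 0 t *v w) \<le> K * norm w"
    and "\<And>t. t \<in> {0..T} \<Longrightarrow> \<Phi> 0 t ** \<Phi> t 0 = mat 1"
proof -
  note bb = bounded_bilinear_matrix_vector_mult
  obtain k where k: "0 < k" "\<And>(N::real^3^3) x. norm (N *v x) \<le> norm N * norm x * k"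
    using bounded_bilinear.pos_bounded[OF bb] by blast
  have "bounded (A ` {0..T})"
    by (intro compact_imp_bounded compact_continuous_image compact_Icc
        continuous_on_subset[OF A]) auto
  then obtain a where a: "0 < a" "\<And>t. t \<in> {0..T} \<Longrightarrow> norm (A t) \<le> a"
    unfolding bounded_pos by blast
  define L where "L = a * k"
  have "0 \<le> L" using a k by (simp add: L_def)
  have L: "norm (A t *v x) \<le> L * norm x" if "t \<in> {0..T}" for t x
  proof -
    have "norm (A t *v x) \<le> norm (A t) * (norm x * k)"
      using k(2)[of "A t" x] by (simp add: mult.assoc)
    also have "\<dots> \<le> a * (norm x * k)"
      using a(2)[OF that] k(1) by (intro mult_right_mono) auto
    finally show ?thesis by (simp add: L_def mult_ac)
  qed
  have der: "((\<lambda>t. \<Phi> t s *v w) has_vector_derivative A t *v (\<Phi> t s *v w)) (at t)" for s t w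
  proof -
    have "((\<lambda>t. \<Phi> t s) has_vector_derivative A t ** \<Phi> t s) (at t)"
      using \<Phi> unfolding state_transition_def by blast
    from bounded_linear.has_vector_derivative
        [OF bounded_bilinear.bounded_linear_left[OF bb] this, of w]
    show ?thesis by (simp add: matrix_vector_mul_assoc)
  qed
  have one: "\<Phi> t t = mat 1" for t
    using \<Phi> unfolding state_transition_def by blast
  show ?thesis
  proof
    fix t w assume t: "t \<in> {0..T}"
    have "norm (\<Phi> 0 t *v w) \<le> exp (L * (t - 0)) * norm (\<Phi> t t *v w)"
      using t by (intro backward_Gronwall[OF _ der L]) auto
    also have "\<dots> \<le> exp (L * T) * norm w"
      using t \<open>0 \<le> L\<close> by (auto simp: one intro!: mult_right_mono mult_left_mono)
    finally show "norm (\<Phi> 0 t *v w) \<le> exp (L * T) * norm w" .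
  next
    fix t assume t: "t \<in> {0..T}"
    have "\<Phi> 0 t *v (\<Phi> t 0 *v w) = w" for w
    proof -
      \<comment> \<open>Both terms solve the linear equation and agree at \<open>s = t\<close>, so
        their difference vanishes at \<open>0\<close> as well.\<close>
      let ?y = "\<lambda>s. \<Phi> s t *v (\<Phi> t 0 *v w) - \<Phi> s 0 *v w"
      have "(?y has_vector_derivative A s *v ?y s) (at s)" for s
        unfolding matrix_vector_mult_diff_distrib
        by (intro has_vector_derivative_diff der)
      then have "norm (?y 0) \<le> exp (L * (t - 0)) * norm (?y t)"
        using t by (intro backward_Gronwall[OF _ _ L]) auto
      then show ?thesis by (simp add: one)
    qed
    then show "\<Phi> 0 t ** \<Phi> t 0 = mat 1"
      by (simp add: matrix_eq matrix_vector_mul_assoc flip: matrix_vector_mul_assoc)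
  qed
qed

text \<open>Pulling \<open>z\<close> back to time \<open>0\<close> cancels the
  \<open>A\<close>-term. \<open>state_transition\<close> differentiates \<Phi> only in its first
  argument, while here the second one varies; hence \<open>\<Phi> 0 s\<close> enters merely as a
  bounded left inverse of \<open>\<Phi> s 0\<close>.\<close>

lemma variation_of_constants_derivative:
  fixes z g :: "real \<Rightarrow> real^3"
  assumes \<Phi>: "state_transition A \<Phi>" and A: "continuous_on UNIV A" and "0 \<le> t"
    and z: "(z has_vector_derivative A t *v z t + g t) (at t within {0..})"
  shows "((\<lambda>s. \<Phi> 0 s *v z s) has_vector_derivative \<Phi> 0 t *v g t) (at t within {0..})"
proof -
  note bb = bounded_bilinear_matrix_vector_mult
  \<comment> \<open>The bound on \<open>\<Phi> 0 s\<close> is available on compact intervals. One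
    unit beyond \<open>t\<close> makes the interval a neighbourhood of \<open>t\<close> in the half
    line, so derivatives within the two sets agree.\<close>
  have "0 \<le> t + 1" using \<open>0 \<le> t\<close> by simp
  from state_transition_inverse[OF \<Phi> A this]
  obtain K where K: "\<And>s w. s \<in> {0..t+1} \<Longrightarrow> norm (\<Phi> 0 s *v w) \<le> K * norm w"
    and inv: "\<And>s. s \<in> {0..t+1} \<Longrightarrow> \<Phi> 0 s ** \<Phi> s 0 = mat 1"
    by blast
  have t: "t \<in> {0..t+1}" using \<open>0 \<le> t\<close> by simp
  have inv': "\<Phi> t 0 ** \<Phi> 0 t = mat 1"
    using inv[OF t] matrix_left_right_inverse by blast
  have "((\<lambda>s. \<Phi> 0 s *v z s) has_vector_derivative \<Phi> 0 t *v g t) (at t within {0..t+1})"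
  proof (rule has_vector_derivative_inverse_apply[where B = "\<lambda>s w. \<Phi> s 0 *v w"
        and C = "\<lambda>s w. \<Phi> 0 s *v w" and D = "\<lambda>w. A t *v (\<Phi> t 0 *v w)"
        and z = z and g = "g t" and K = K])
    fix w
    have "((\<lambda>s. \<Phi> s 0) has_vector_derivative A t ** \<Phi> t 0) (at t)"
      using \<Phi> unfolding state_transition_def by blast
    from bounded_linear.has_vector_derivative
        [OF bounded_bilinear.bounded_linear_left[OF bb] this, of w]
    show "((\<lambda>s. \<Phi> s 0 *v w) has_vector_derivative A t *v (\<Phi> t 0 *v w)) (at t within {0..t+1})"
      unfolding matrix_vector_mul_assoc by (rule has_vector_derivative_at_within)
    show "\<Phi> t 0 *v (\<Phi> 0 t *v w) = w"
      by (simp add: matrix_vector_mul_assoc inv')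
  next
    show "(z has_vector_derivative A t *v (\<Phi> t 0 *v (\<Phi> 0 t *v z t)) + g t) (at t within {0..t+1})"
      unfolding matrix_vector_mul_assoc[of "\<Phi> t 0"] inv'
      using has_vector_derivative_within_subset[OF z, of "{0..t+1}"] by simp
  next
    fix s w assume "s \<in> {0..t+1}"
    then show "\<Phi> 0 s *v (\<Phi> s 0 *v w) = w" "norm (\<Phi> 0 s *v w) \<le> K * norm w"
      using K inv by (auto simp: matrix_vector_mul_assoc)
  qed simp
  moreover have "at t within {0..t+1} = at t within {0..}"
    using \<open>0 \<le> t\<close> by (intro at_within_nhd[of t "{..<t+1}"]) auto
  ultimately show ?thesis by simp
qed

section \<open>Decay of the adjoint solution and the resulting integral identity\<close>

lemma psi_star_inner: "psi_star \<Phi> e t \<bullet> x = e \<bullet> (\<Phi> 0 t *v x)"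
  unfolding psi_star_def by (simp add: dot_lmul_matrix flip: vector_transpose_matrix)

lemma algebraic_growth_plusD:
  assumes "algebraic_growth_plus z"
  obtains C \<mu> where "\<And>t. 0 \<le> t \<Longrightarrow> norm (z t) \<le> C * (t + 1) powr \<mu>"
proof -
  from assms obtain \<mu> C where C: "\<And>t. 0 \<le> t \<Longrightarrow> norm (z t) * (\<bar>t\<bar> + 1) powr (- \<mu>) \<le> C"
    unfolding algebraic_growth_plus_def Cb_plus_def bdd_above_def by force
  have "norm (z t) \<le> C * (t + 1) powr \<mu>" if "0 \<le> t" for t
    using C[OF that] that by (simp add: powr_minus field_simps)
  then show ?thesis using that by blast
qed

text \<open>Only the component of \<open>z t\<close> in the range of \<open>mat 1 - P t\<close>
  contributes to the pairing, and on it \<open>\<Phi> 0 t\<close> decays exponentially, faster than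
  \<open>z\<close> can grow.\<close>

lemma psi_star_decay:
  assumes P: "dichotomy_projections \<Phi> P U V W"
    and orth: "\<And>x. x \<in> U + V \<Longrightarrow> e \<bullet> x = 0"
    and z: "algebraic_growth_plus z"
  shows "((\<lambda>t. psi_star \<Phi> e t \<bullet> z t) \<longlongrightarrow> 0) at_top"
proof -
  obtain C \<mu> where C: "\<And>t. 0 \<le> t \<Longrightarrow> norm (z t) \<le> C * (t + 1) powr \<mu>"
    using algebraic_growth_plusD[OF z] by blast
  \<comment> \<open>The second dichotomy bound at \<open>s = 0\<close>; \<open>t - 0\<close> stays
    unsimplified to match it literally.\<close>
  obtain K \<eta> where "1 \<le> K" "0 < \<eta>" and
    K: "\<And>t. 0 \<le> t \<Longrightarrow> onorm (\<lambda>x. (\<Phi> 0 t ** (mat 1 - P t)) *v x) \<le> K * exp (- \<eta> * (t - 0))"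
    using P unfolding dichotomy_projections_def by (metis order_refl)
  have le: "\<bar>psi_star \<Phi> e t \<bullet> z t\<bar> \<le> norm e * K * C * (exp (- \<eta> * t) * (t + 1) powr \<mu>)"
    if t: "0 \<le> t" for t
  proof -
    have comm: "P 0 ** \<Phi> 0 t = \<Phi> 0 t ** P t"
      and range: "range (\<lambda>x. P 0 *v x) = U + V"
      using P t unfolding dichotomy_projections_def by auto
    \<comment> \<open>Commuting \<open>P\<close> past \<Phi> moves this vector into the range of
      \<open>P 0\<close>, which \<open>e\<close> annihilates.\<close>
    have "e \<bullet> ((\<Phi> 0 t ** P t) *v z t) = 0"
      unfolding comm[symmetric]
      by (rule orth) (simp flip: range matrix_vector_mul_assoc)
    then have "psi_star \<Phi> e t \<bullet> z t = e \<bullet> ((\<Phi> 0 t ** (mat 1 - P t)) *v z t)"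
      unfolding psi_star_inner
      by (simp add: matrix_vector_mult_diff_rdistrib matrix_vector_mult_diff_distrib inner_diff_right
          flip: matrix_vector_mul_assoc)
    also have "\<bar>\<dots>\<bar> \<le> norm e * norm ((\<Phi> 0 t ** (mat 1 - P t)) *v z t)"
      by (rule Cauchy_Schwarz_ineq2)
    also have "\<dots> \<le> norm e * (K * exp (- \<eta> * (t - 0)) * (C * (t + 1) powr \<mu>))"
      using \<open>1 \<le> K\<close>
      by (intro mult_left_mono order_trans[OF onorm[OF matrix_vector_mul_bounded_linear]]
          mult_mono K[OF t] C[OF t]) auto
    finally show ?thesis by (simp add: mult_ac)
  qed
  have "((\<lambda>t. exp (- \<eta> * t) * (t + 1) powr \<mu>) \<longlongrightarrow> 0) at_top"
    using \<open>0 < \<eta>\<close> by real_asymp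
  from tendsto_mult_right_zero[OF this]
  have "((\<lambda>t. norm e * K * C * (exp (- \<eta> * t) * (t + 1) powr \<mu>)) \<longlongrightarrow> 0) at_top" .
  then show ?thesis
    by (rule Lim_null_comparison[rotated])
      (use le in \<open>auto intro!: eventually_at_top_linorderI[of 0]\<close>)
qed

text \<open>Only boundary terms remain: the pairing tends to \<open>0\<close> at infinity and equals
  \<open>e \<bullet> z 0\<close> at time \<open>0\<close>, since \<open>\<Phi> 0 0\<close> is the
  identity.\<close>

lemma psi_star_has_integral:
  fixes z g :: "real \<Rightarrow> real^3"
  assumes \<Phi>: "state_transition A \<Phi>" and A: "continuous_on UNIV A"
    and P: "dichotomy_projections \<Phi> P U V W"
    and orth: "\<And>x. x \<in> U + V \<Longrightarrow> e \<bullet> x = 0"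
    and growth: "algebraic_growth_plus z"
    and z: "\<And>t. 0 \<le> t \<Longrightarrow> (z has_vector_derivative A t *v z t + g t) (at t within {0..})"
  shows "((\<lambda>s. psi_star \<Phi> e s \<bullet> g s) has_integral - (e \<bullet> z 0)) {0..}"
proof -
  have "((\<lambda>t. psi_star \<Phi> e t \<bullet> z t) has_vector_derivative psi_star \<Phi> e t \<bullet> g t) (at t within {0..})"
    if "0 \<le> t" for t
    unfolding psi_star_inner
    by (rule bounded_linear.has_vector_derivative[OF bounded_linear_inner_right])
      (rule variation_of_constants_derivative[where g = g, OF \<Phi> A that z[OF that]])
  from has_integral_halfline_FTC[OF this psi_star_decay[OF P orth growth]]
  have "((\<lambda>s. psi_star \<Phi> e s \<bullet> g s) has_integral (0 - psi_star \<Phi> e 0 \<bullet> z 0)) {0..}"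
    by blast
  then show ?thesis
    using \<Phi> by (simp add: psi_star_inner state_transition_def)
qed

section \<open>Reversibility and the splitting formula\<close>

text \<open>As \<sigma> is an involution, a point lies in the image of \<open>Wcs\<close> exactly
  when its own image lies in \<open>Wcs\<close>. On the section, \<sigma> only changes signs of
  orthogonal coordinates, so it preserves the ball.\<close>

lemma reversor_section_mem_iff:
  assumes \<sigma>: "\<sigma> ** \<sigma> = mat 1"
    and ev: "\<sigma> *v e\<^sub>v = \<sigma>\<^sub>v *\<^sub>R e\<^sub>v" and ew: "\<sigma> *v e\<^sub>w = \<sigma>\<^sub>w *\<^sub>R e\<^sub>w"
    and signs: "\<sigma>\<^sub>v \<in> {1, -1}" "\<sigma>\<^sub>w \<in> {1, -1}" and orth: "e\<^sub>v \<bullet> e\<^sub>w = 0"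
    and sub: "subspace V" "subspace W" "e\<^sub>v \<in> V" "e\<^sub>w \<in> W"
    and S: "S = (V + W) \<inter> ball 0 r"
  shows "v *\<^sub>R e\<^sub>v + w *\<^sub>R e\<^sub>w \<in> Wcu \<sigma> M \<alpha> \<inter> S \<longleftrightarrow>
    (\<sigma>\<^sub>v * v) *\<^sub>R e\<^sub>v + (\<sigma>\<^sub>w * w) *\<^sub>R e\<^sub>w \<in> Wcs M \<alpha> \<inter> S"
proof -
  let ?p = "v *\<^sub>R e\<^sub>v + w *\<^sub>R e\<^sub>w" and ?q = "(\<sigma>\<^sub>v * v) *\<^sub>R e\<^sub>v + (\<sigma>\<^sub>w * w) *\<^sub>R e\<^sub>w"
  have q: "\<sigma> *v ?p = ?q"
    unfolding matrix_vector_right_distrib matrix_vector_mult_scaleR ev ew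
    by (simp add: mult.commute)
  have invol: "\<sigma> *v (\<sigma> *v x) = x" for x
    by (simp add: matrix_vector_mul_assoc \<sigma>)
  have "?p \<in> Wcu \<sigma> M \<alpha> \<longleftrightarrow> ?q \<in> Wcs M \<alpha>"
    unfolding Wcu_def q[symmetric]
    by (auto simp: invol intro: image_eqI[where x = "\<sigma> *v ?p"])
  moreover have "norm ?p = norm ?q"
    using signs orth by (auto simp: norm_eq inner_add_left inner_add_right inner_commute)
  moreover have "a *\<^sub>R e\<^sub>v + b *\<^sub>R e\<^sub>w \<in> V + W" for a b
    by (intro set_plus_intro subspace_scale sub)
  ultimately show ?thesis
    unfolding S by auto
qed

theorem theorem2p8:
  fixes f :: "real^3 \<Rightarrow> real \<Rightarrow> real^3"
    and \<sigma> :: "real^3^3"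
    and \<gamma> :: "real \<Rightarrow> real^3"
    and M :: "((real^3) \<times> real) set"
    and U V W S :: "(real^3) set"
    and e\<^sub>u e\<^sub>v e\<^sub>w :: "real^3"
    and \<nu> r \<sigma>\<^sub>v \<sigma>\<^sub>w :: real
    and \<Phi> :: "real \<Rightarrow> real \<Rightarrow> real^3^3"
    and P :: "real \<Rightarrow> real^3^3"
    and h\<^sub>c\<^sub>s h\<^sub>c\<^sub>u :: "real \<Rightarrow> real \<Rightarrow> real"
    and zstar :: "real \<Rightarrow> real \<Rightarrow> real \<Rightarrow> real^3"
  assumes smooth: "smooth_on UNIV (\<lambda>(x, \<alpha>). f x \<alpha>)"
    and H1: "H1 f \<sigma>"
    and H2: "H2 f \<sigma> \<gamma>"
    and nu: "0 < \<nu>"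
    and H3: "H3 f \<gamma> \<nu> M"
    and H4: "H4 \<sigma> \<gamma> M U V"
    and W: "W = orthogonal_comp (tangent_space (Wcs M 0) (\<gamma> 0))"
    and unit: "norm e\<^sub>u = 1" "norm e\<^sub>v = 1" "norm e\<^sub>w = 1"
    and spans: "span {e\<^sub>u} = U" "span {e\<^sub>v} = V" "span {e\<^sub>w} = W"
    and signs: "\<sigma>\<^sub>v \<in> {1, -1}" "\<sigma>\<^sub>w \<in> {1, -1}"
    and sigma_diag: "\<sigma> *v e\<^sub>u = - e\<^sub>u" "\<sigma> *v e\<^sub>v = \<sigma>\<^sub>v *\<^sub>R e\<^sub>v" "\<sigma> *v e\<^sub>w = \<sigma>\<^sub>w *\<^sub>R e\<^sub>w"
    and sigma_transpose: "transpose \<sigma> *v e\<^sub>w = \<sigma>\<^sub>w *\<^sub>R e\<^sub>w"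
    and r: "0 < r"
    and S: "S = (V + W) \<inter> ball (\<gamma> 0) r"
    and Phi: "state_transition (lin f \<gamma>) \<Phi>"
    and P: "dichotomy_projections \<Phi> P U V W"
    and cut_off: "cut_off f \<gamma> \<nu> M \<Phi> P e\<^sub>v e\<^sub>w S"
    and graph_cs: "local_graph e\<^sub>v e\<^sub>w S (Wcs M) h\<^sub>c\<^sub>s"
    and graph_cu: "local_graph e\<^sub>v e\<^sub>w S (Wcu \<sigma> M) h\<^sub>c\<^sub>u"
    and zstar: "\<forall>\<^sub>F (v, \<alpha>) in nhds (0, 0).
        algebraic_growth_plus (zstar v \<alpha>) \<and>
        (\<forall>t\<ge>0. (zstar v \<alpha> has_vector_derivative
           lin f \<gamma> t *v zstar v \<alpha> t + remainder f \<gamma> t (zstar v \<alpha> t) \<alpha>) (at t within {0..})) \<and>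
        zstar v \<alpha> 0 = v *\<^sub>R e\<^sub>v + h\<^sub>c\<^sub>s v \<alpha> *\<^sub>R e\<^sub>w"
  shows "\<forall>\<^sub>F (v, \<alpha>) in nhds (0, 0).
    ((\<lambda>s. psi_star \<Phi> e\<^sub>w s \<bullet>
        (remainder f \<gamma> s (zstar v \<alpha> s) \<alpha>
         - \<sigma>\<^sub>w *\<^sub>R remainder f \<gamma> s (zstar (\<sigma>\<^sub>v * v) \<alpha> s) \<alpha>))
      has_integral splitting h\<^sub>c\<^sub>s h\<^sub>c\<^sub>u v \<alpha>) {0..}"
proof -
  have \<gamma>0: "\<gamma> 0 = 0" and sol: "solution_on f 0 UNIV \<gamma>"
    using H2 unfolding H2_def by blast+
  have "continuous_on UNIV \<gamma>"
    using sol unfolding solution_on_def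
    by (auto simp: continuous_on_eq_continuous_at intro: has_vector_derivative_continuous)
  from continuous_lin[OF smooth this] have A: "continuous_on UNIV (lin f \<gamma>)" .
  have subV: "subspace V" and tangent: "U + V \<subseteq> tangent_space (Wcs M 0) (\<gamma> 0)"
    using H4 unfolding H4_def by auto
  have evV: "e\<^sub>v \<in> V" and ewW: "e\<^sub>w \<in> W"
    using spans by (auto simp: span_base)
  \<comment> \<open>By (H4), \<open>U + V\<close> lies in the tangent space of
    \<open>Wcs M 0\<close>, whose orthogonal complement is \<open>W\<close>.\<close>
  have orth: "e\<^sub>w \<bullet> x = 0" if "x \<in> U + V" for x
    using ewW that tangent unfolding W orthogonal_comp_def orthogonal_def
    by (auto simp: inner_commute)
  have "0 \<in> U"
    using spans(1) by (metis span_zero)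
  then have "e\<^sub>v \<in> U + V"
    using set_plus_intro[OF _ evV, of 0 U] by simp
  then have vw: "e\<^sub>w \<bullet> e\<^sub>v = 0"
    by (rule orth)
  have subW: "subspace W"
    using spans(3) by (metis subspace_span)
  have sec: "v *\<^sub>R e\<^sub>v + w *\<^sub>R e\<^sub>w \<in> Wcu \<sigma> M \<alpha> \<inter> S \<longleftrightarrow>
      (\<sigma>\<^sub>v * v) *\<^sub>R e\<^sub>v + (\<sigma>\<^sub>w * w) *\<^sub>R e\<^sub>w \<in> Wcs M \<alpha> \<inter> S" for v w \<alpha>
    using H1 vw S \<gamma>0 evV ewW subV subW sigma_diag signs unfolding H1_def
    by (intro reversor_section_mem_iff) (auto simp: inner_commute)
  have int: "((\<lambda>s. psi_star \<Phi> e\<^sub>w s \<bullet> remainder f \<gamma> s (zstar v \<alpha> s) \<alpha>)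
      has_integral - h\<^sub>c\<^sub>s v \<alpha>) {0..}"
    if "algebraic_growth_plus (zstar v \<alpha>) \<and>
        (\<forall>t\<ge>0. (zstar v \<alpha> has_vector_derivative
           lin f \<gamma> t *v zstar v \<alpha> t + remainder f \<gamma> t (zstar v \<alpha> t) \<alpha>) (at t within {0..})) \<and>
        zstar v \<alpha> 0 = v *\<^sub>R e\<^sub>v + h\<^sub>c\<^sub>s v \<alpha> *\<^sub>R e\<^sub>w" for v \<alpha>
  proof -
    \<comment> \<open>Pairing with the unit vector \<open>e\<^sub>w\<close>, orthogonal to
      \<open>e\<^sub>v\<close>, reads off the \<open>w\<close>-coordinate.\<close>
    have "e\<^sub>w \<bullet> zstar v \<alpha> 0 = h\<^sub>c\<^sub>s v \<alpha>"
      using that unit(3) vw by (simp add: inner_add_right dot_square_norm)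
    then show ?thesis
      using psi_star_has_integral[OF Phi A P orth, where z = "zstar v \<alpha>"
          and g = "\<lambda>s. remainder f \<gamma> s (zstar v \<alpha> s) \<alpha>"] that by simp
  qed
  let ?o = "(0, 0) :: real \<times> real"
  \<comment> \<open>The formula at \<open>(v, \<alpha>)\<close> also involves the data at
    \<open>(\<sigma>\<^sub>v * v, \<alpha>)\<close>. This reflection is continuous and fixes the
    origin, so statements valid near the origin can be pulled back along it.\<close>
  have "((\<lambda>p. (\<sigma>\<^sub>v * fst p, snd p)) \<longlongrightarrow> (\<sigma>\<^sub>v * fst ?o, snd ?o)) (nhds ?o)"
    by (intro tendsto_intros filterlim_ident)
  then have flip: "filterlim (\<lambda>p. (\<sigma>\<^sub>v * fst p, snd p)) (nhds ?o) (nhds ?o)"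
    by simp
  note zstar' = eventually_compose_filterlim[OF zstar flip]
  note graph_cs' = eventually_compose_filterlim[OF graph_cs[unfolded local_graph_def] flip]
  show ?thesis
    using zstar zstar' graph_cs' graph_cu[unfolded local_graph_def]
  proof eventually_elim
    case (elim p)
    obtain v \<alpha> where p: "p = (v, \<alpha>)" by fastforce
    \<comment> \<open>The point of the graph of \<open>h\<^sub>c\<^sub>u\<close> over
      \<open>v\<close> is reflected by \<open>sec\<close> to a point of \<open>Wcs\<close> over
      \<open>\<sigma>\<^sub>v * v\<close>, where the graph property leaves a single
      \<open>w\<close>-coordinate.\<close>
    have "\<sigma>\<^sub>w * h\<^sub>c\<^sub>u v \<alpha> = h\<^sub>c\<^sub>s (\<sigma>\<^sub>v * v) \<alpha>"
      using elim(3,4) sec by (simp add: p)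
    then have hcu: "h\<^sub>c\<^sub>u v \<alpha> = \<sigma>\<^sub>w * h\<^sub>c\<^sub>s (\<sigma>\<^sub>v * v) \<alpha>"
      using signs(2) by auto
    have 1: "((\<lambda>s. psi_star \<Phi> e\<^sub>w s \<bullet> remainder f \<gamma> s (zstar v \<alpha> s) \<alpha>)
        has_integral - h\<^sub>c\<^sub>s v \<alpha>) {0..}"
      using elim(1) by (intro int) (simp add: p)
    have 2: "((\<lambda>s. psi_star \<Phi> e\<^sub>w s \<bullet> remainder f \<gamma> s (zstar (\<sigma>\<^sub>v * v) \<alpha> s) \<alpha>)
        has_integral - h\<^sub>c\<^sub>s (\<sigma>\<^sub>v * v) \<alpha>) {0..}"
      using elim(2) by (intro int) (simp add: p)
    \<comment> \<open>The integral equals \<open>- h\<^sub>c\<^sub>s v \<alpha> + \<sigma>\<^sub>w *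
      h\<^sub>c\<^sub>s (\<sigma>\<^sub>v * v) \<alpha>\<close>, and \<open>hcu\<close> identifies
      the last term as \<open>h\<^sub>c\<^sub>u v \<alpha>\<close>.\<close>
    from has_integral_diff[OF 1 has_integral_mult_right[OF 2, of \<sigma>\<^sub>w]]
    show ?case
      by (simp add: p splitting_def hcu inner_diff_right)
  qed
qed

end
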